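(* Let $n$ be a positive odd integer, let $p_1,\dots,p_n$ be odd integers (of arbitrary signs), and let $P=P(p_1,p_2,\dots,p_n)$ be the corresponding pretzel knot (of odd type). Let $a_2(P)$ be the second coefficient of its Conway polynomial. Then $$a_2(P)=\frac14\sum_{1\le i<j\le n}p_ip_j+\frac18(n-1)\quad\left(=\frac18\left\{\Bigl(\sum_{i=1}^{n}p_i\Bigr)^2-\sum_{i=1}^{n}p_i^2\right\}+\frac18(n-1)\right).$$
   Context: The Conway polynomial $\nabla_L(z)$ of an oriented link is defined by $\nabla_O=1$ for the trivial knot $O$ and $\nabla_{L_+}-\nabla_{L_-}=z\nabla_{L_0}$; for a knot $K$, the second coefficient $a_2(K)$ is the coefficient of $z^2$. The pretzel link $P(p_1,\dots,p_n)$ is obtained from $n$ vertical two-strand twisted columns (twisted bands) placed side by side, the $i$-th having $|p_i|$ half-twists (crossings) with handedness given by the sign of $p_i$, by joining adjacent columns cyclically at the top and at the bottom in the standard way. It is a knot iff exactly one $p_i$ is even, or all $p_i$ are odd and $n$ is odd; in the latter case it is called of odd type. Knots are not distinguished from their mirror images ($a_2$ is invariant under mirror image). *)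

theory Defs
  imports Complex_Main "HOL-Computational_Algebra.Polynomial"
begin

text \<open>
  Links are represented by planar diagrams in Morse position, read from bottom to top: a diagram
  is a list of elementary pieces, each placed at a horizontal position (the number of strands to
  its left).  Planarity is thus built in.  A cup is a local minimum (it creates two strands), a cap
  is a local maximum (it joins two strands), and \<open>Cross k\<close> is a crossing of two strands, where the
  strand running from bottom left to top right is the upper one iff \<open>k\<close> is true.  The type parameter
  is a decoration of the cups: \<open>unit\<close> for unoriented diagrams, \<open>bool\<close> for oriented ones.
\<close>

datatype 'o piece = Cup 'o | Cap | Cross bool

type_synonym 'o diagram = "('o piece \<times> nat) list"

text \<open>
  The state of an oriented diagram between two pieces is the list of directions of the strands from
  left to right, with \<open>True\<close> for upwards.  \<open>Cup d\<close> is oriented such that its left leg has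
  direction \<open>d\<close>.
\<close>

inductive piece_path :: "bool list \<Rightarrow> bool piece \<times> nat \<Rightarrow> bool list \<Rightarrow> bool" where
  Cup: "length l = i \<Longrightarrow> piece_path (l @ r) (Cup d, i) (l @ [d, \<not> d] @ r)"
| Cap: "length l = i \<Longrightarrow> piece_path (l @ [d, \<not> d] @ r) (Cap, i) (l @ r)"
| Cross: "length l = i \<Longrightarrow> piece_path (l @ [a, b] @ r) (Cross k, i) (l @ [b, a] @ r)"

inductive path :: "bool list \<Rightarrow> bool diagram \<Rightarrow> bool list \<Rightarrow> bool" where
  Nil: "path s [] s"
| Cons: "piece_path s x t \<Longrightarrow> path t D u \<Longrightarrow> path s (x # D) u"

definition link_diagram :: "bool diagram \<Rightarrow> bool" where
  "link_diagram D \<longleftrightarrow> path [] D []"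

fun width_in :: "'o piece \<Rightarrow> nat" where
  "width_in (Cup d) = 0"
| "width_in Cap = 2"
| "width_in (Cross k) = 2"

fun width_out :: "'o piece \<Rightarrow> nat" where
  "width_out (Cup d) = 2"
| "width_out Cap = 0"
| "width_out (Cross k) = 2"

text \<open>
  The standard generating moves for isotopy of link diagrams in Morse position: the planar isotopies
  (exchange of heights of distant pieces, straightening of a zigzag, sliding a strand over or
  under a local extremum) and the three Reidemeister moves.  The remaining versions of the
  Reidemeister moves (other kinks, rotated strands, other crossing patterns in the third move)
  are consequences of those listed.  No orientations need to be compared on the two sides, because
  moves are only applied between diagrams both of which are consistently oriented.
\<close>

inductive move :: "bool diagram \<Rightarrow> bool diagram \<Rightarrow> bool" where
  exchange: "move [(y, i + width_in x + m), (x, i)] [(x, i), (y, i + width_out x + m)]"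
| zigzag_left: "move [(Cup d, i), (Cap, i + 1)] []"
| zigzag_right: "move [(Cup d, i + 1), (Cap, i)] []"
| slide_cup: "move [(Cup d, i), (Cross k, i + 1)] [(Cup d, i + 1), (Cross (\<not> k), i)]"
| slide_cap: "move [(Cross k, i), (Cap, i + 1)] [(Cross (\<not> k), i + 1), (Cap, i)]"
| R1_cup: "move [(Cup d, i), (Cross k, i)] [(Cup (\<not> d), i)]"
| R1_cap: "move [(Cross k, i), (Cap, i)] [(Cap, i)]"
| R2: "move [(Cross k, i), (Cross (\<not> k), i)] []"
| R3: "move [(Cross k, i), (Cross k, i + 1), (Cross k, i)]
            [(Cross k, i + 1), (Cross k, i), (Cross k, i + 1)]"

inductive isotopic :: "bool diagram \<Rightarrow> bool diagram \<Rightarrow> bool" where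
  refl: "link_diagram D \<Longrightarrow> isotopic D D"
| sym: "isotopic D E \<Longrightarrow> isotopic E D"
| trans: "isotopic D E \<Longrightarrow> isotopic E F \<Longrightarrow> isotopic D F"
| move: "move x y \<Longrightarrow> link_diagram (u @ x @ v) \<Longrightarrow> link_diagram (u @ y @ v)
    \<Longrightarrow> isotopic (u @ x @ v) (u @ y @ v)"

text \<open>
  \<open>skein_triple D\<^sub>+ D\<^sub>- D\<^sub>0\<close>: three link diagrams that differ only at one crossing, which is positive,
  negative, and smoothed according to the orientation, respectively.  If the two strands are both
  directed upwards or both downwards, then \<open>Cross True\<close> is the positive crossing, and the smoothing
  consists of two vertical strands.  If exactly one of them is directed upwards, the sign is the
  opposite one, and the smoothing is a cap below a cup.
\<close>

inductive skein_triple :: "bool diagram \<Rightarrow> bool diagram \<Rightarrow> bool diagram \<Rightarrow> bool" where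
  parallel: "path [] u (l @ [a, a] @ r) \<Longrightarrow> path (l @ [a, a] @ r) v [] \<Longrightarrow> length l = i \<Longrightarrow>
    skein_triple (u @ [(Cross True, i)] @ v) (u @ [(Cross False, i)] @ v) (u @ v)"
| antiparallel: "path [] u (l @ [a, \<not> a] @ r) \<Longrightarrow> path (l @ [\<not> a, a] @ r) v [] \<Longrightarrow> length l = i \<Longrightarrow>
    skein_triple (u @ [(Cross False, i)] @ v) (u @ [(Cross True, i)] @ v)
      (u @ [(Cap, i), (Cup (\<not> a), i)] @ v)"

definition trivial_knot :: "bool diagram" where
  "trivial_knot = [(Cup True, 0), (Cap, 0)]"

text \<open>
  The defining properties of the Conway polynomial, as an invariant of oriented links: \<open>[:0, 1:]\<close> is
  the variable \<open>z\<close>.  Its values on lists that are not link diagrams are irrelevant.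
\<close>

definition conway_polynomial :: "(bool diagram \<Rightarrow> int poly) \<Rightarrow> bool" where
  "conway_polynomial C \<longleftrightarrow>
    (\<forall>D E. isotopic D E \<longrightarrow> C D = C E) \<and>
    C trivial_knot = 1 \<and>
    (\<forall>Dp Dm D0. skein_triple Dp Dm D0 \<longrightarrow> C Dp - C Dm = [:0, 1:] * C D0)"

definition a2 :: "(bool diagram \<Rightarrow> int poly) \<Rightarrow> bool diagram \<Rightarrow> int" where
  "a2 C D = coeff (C D) 2"

text \<open>
  Column \<open>j < n\<close> (counted from \<open>0\<close>) of the pretzel diagram occupies the positions \<open>2 j\<close> and
  \<open>2 j + 1\<close>.  The first cup and the last cap are the outer arcs joining column \<open>n - 1\<close> to column
  \<open>0\<close>; the cup and the cap at position \<open>2 j + 1\<close> join column \<open>j\<close> to column \<open>j + 1\<close>.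
  The choice of \<open>Cross True\<close> for positive \<open>p\<^sub>j\<close> fixes one of the two mirror images.
\<close>

definition pretzel :: "int list \<Rightarrow> unit diagram" where
  "pretzel ps = (let n = length ps in
     [(Cup (), 0)] @ map (\<lambda>j. (Cup (), 2 * j + 1)) [0..<n - 1]
     @ concat (map (\<lambda>j. replicate (nat \<bar>ps ! j\<bar>) (Cross (ps ! j > 0), 2 * j)) [0..<n])
     @ rev (map (\<lambda>j. (Cap, 2 * j + 1)) [0..<n - 1]) @ [(Cap, 0)])"

definition unoriented :: "'o diagram \<Rightarrow> unit diagram" where
  "unoriented D = map (map_prod (map_piece (\<lambda>_. ())) id) D"

text \<open>The pretzel link, with an arbitrary orientation of its components.\<close>

definition oriented_pretzel :: "int list \<Rightarrow> bool diagram \<Rightarrow> bool" where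
  "oriented_pretzel ps D \<longleftrightarrow> link_diagram D \<and> unoriented D = pretzel ps"

end

theory Submission
  imports Defs
begin

text \<open>
  An odd number of odd columns forces the two strands of every column to be antiparallel.  Hence
  lowering \<open>p\<^sub>j\<close> by 2 is the change of a negative crossing to a positive one, whose smoothing
  cuts the column: the rest of it becomes kinks and the arcs straighten, which leaves the pretzel
  link without \<open>p\<^sub>j\<close>.  Applying this to the last two columns only, one brings them to
  \<open>1, -1\<close>, and such a pair of columns cancels by a second Reidemeister move.  With
  \<open>\<nabla>(ps)\<close> the Conway polynomial of \<open>P(ps)\<close>, \<open>p = 2 k + 1\<close> and \<open>q = 2 j + 1\<close>, this reads
  \<open>\<nabla>(qs, p, q) = \<nabla>(qs) - (j + 1) z \<nabla>(qs, 1) - k z \<nabla>(qs, q)\<close>,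
  where the first term is 0 (a split link) if \<open>qs\<close> is empty.
  The recursion mixes knots (an odd number of columns) with two-component links (an even number),
  so \<open>a\<^sub>0\<close>, \<open>a\<^sub>1\<close> (the linking number) and \<open>a\<^sub>2\<close> are determined together.
\<close>

section \<open>Paths and local moves\<close>

lemma path_Nil_iff [simp]: "path s [] t \<longleftrightarrow> s = t"
  by (auto intro: path.Nil elim: path.cases)

lemma path_Cons_iff [simp]: "path s (x # D) t \<longleftrightarrow> (\<exists>m. piece_path s x m \<and> path m D t)"
  by (auto intro: path.Cons elim: path.cases)

lemma path_append_iff [simp]: "path s (D @ E) t \<longleftrightarrow> (\<exists>m. path s D m \<and> path m E t)"
  by (induction D arbitrary: s) auto

lemma piece_path_0 [simp]:
  "piece_path s (Cup d, 0) t \<longleftrightarrow> t = d # (\<not> d) # s"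
  "piece_path s (Cap, 0) t \<longleftrightarrow> (\<exists>d. s = d # (\<not> d) # t)"
  "piece_path s (Cross k, 0) t \<longleftrightarrow> (\<exists>a b r. s = a # b # r \<and> t = b # a # r)"
  by (auto simp: piece_path.simps)

lemma piece_path_Suc [simp]:
  "piece_path s (x, Suc i) t \<longleftrightarrow> (\<exists>b s' t'. s = b # s' \<and> t = b # t' \<and> piece_path s' (x, i) t')"
proof
  assume "piece_path s (x, Suc i) t"
  then show "\<exists>b s' t'. s = b # s' \<and> t = b # t' \<and> piece_path s' (x, i) t'"
    by cases (auto simp: length_Suc_conv intro: piece_path.intros[simplified])
next
  assume "\<exists>b s' t'. s = b # s' \<and> t = b # t' \<and> piece_path s' (x, i) t'"
  then obtain b s' t' where st: "s = b # s'" "t = b # t'" "piece_path s' (x, i) t'" by blast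
  from st(3) show "piece_path s (x, Suc i) t"
  proof cases
    case (Cup l r d)
    then show ?thesis using piece_path.Cup[of "b # l" "Suc i" r d] st by simp
  next
    case (Cap l d r)
    then show ?thesis using piece_path.Cap[of "b # l" "Suc i" d r] st by simp
  next
    case (Cross l a c r k)
    then show ?thesis using piece_path.Cross[of "b # l" "Suc i" a c r k] st by simp
  qed
qed

text \<open>Cups carry their direction, so the state below a piece determines the state above it.
  This later identifies the states of an arbitrary orientation with computed ones.\<close>

lemma piece_path_functional: "piece_path s x t \<Longrightarrow> piece_path s x t' \<Longrightarrow> t = t'"
proof (induction "snd x" arbitrary: s x t t')
  case 0
  then show ?case by (cases x; cases "fst x") auto
next
  case (Suc i)
  then obtain y where x: "x = (y, Suc i)" by (cases x) auto
  show ?case using Suc(3,4) Suc(1)[of "(y, i)"] unfolding x by auto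
qed

lemma path_functional: "path s D t \<Longrightarrow> path s D t' \<Longrightarrow> t = t'"
  by (induction D arbitrary: s) (auto dest: piece_path_functional)

section \<open>Horizontal translation and exchange of heights\<close>

abbreviation shift :: "nat \<Rightarrow> bool diagram \<Rightarrow> bool diagram" where
  "shift i \<equiv> map (apsnd ((+) i))"

lemma path_shift_Suc:
  "path s (shift (Suc i) D) t \<longleftrightarrow>
    (if D = [] then s = t else \<exists>b s' t'. s = b # s' \<and> t = b # t' \<and> path s' (shift i D) t')"
proof (induction D arbitrary: s)
  case (Cons c D)
  have c: "apsnd ((+) (Suc i)) c = (fst c, Suc (i + snd c))" "apsnd ((+) i) c = (fst c, i + snd c)"
    by (cases c; simp)+
  show ?case
  proof (cases "D = []")
    case False
    then show ?thesis
      unfolding list.map path_Cons_iff Cons.IH c piece_path_Suc by auto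
  next
    case True
    show ?thesis
      unfolding True list.map path_Cons_iff c piece_path_Suc by auto
  qed
qed simp

text \<open>Reduces the orientation condition at position \<open>i\<close> to position 0. A path
  through a shifted nonempty \<open>x\<close> guarantees the \<open>i\<close> strands on the left
  that the shifted \<open>y\<close> requires.\<close>

lemma path_shift_mono:
  assumes "\<And>s t. path s x t \<Longrightarrow> path s y t" "x \<noteq> []"
  shows "path s (shift i x) t \<Longrightarrow> path s (shift i y) t"
proof (induction i arbitrary: s t)
  case 0
  then show ?case using assms(1) by (simp add: apsnd_def map_prod_def split_def)
next
  case (Suc i)
  then show ?case using assms(2) unfolding path_shift_Suc by (cases "y = []") auto
qed

lemma exchange_path_0:
  "path s [(y, width_in x + m), (x, 0)] t \<longleftrightarrow> path s [(x, 0), (y, width_out x + m)] t"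
proof -
  have two: "piece_path s (y, Suc (Suc m)) t \<longleftrightarrow>
      (\<exists>a b s' t'. s = a # b # s' \<and> t = a # b # t' \<and> piece_path s' (y, m) t')" for s t
    unfolding piece_path_Suc by blast
  show ?thesis
  proof (cases x)
    case (Cup d)
    then show ?thesis
      by (simp only: width_in.simps width_out.simps path_Cons_iff path_Nil_iff piece_path_0 two
          numeral_2_eq_2 add_Suc add_0) force
  next
    case Cap
    then show ?thesis
      by (simp only: width_in.simps width_out.simps path_Cons_iff path_Nil_iff piece_path_0 two
          numeral_2_eq_2 add_Suc add_0) force
  next
    case (Cross k)
    then show ?thesis
      by (simp only: width_in.simps width_out.simps path_Cons_iff path_Nil_iff piece_path_0 two
          numeral_2_eq_2 add_Suc add_0) force
  qed
qed

lemma exchange_path: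
  "path s [(y, i + width_in x + m), (x, i)] t
    \<longleftrightarrow> path s [(x, i), (y, i + width_out x + m)] t"
  using path_shift_mono[of "[(y, width_in x + m), (x, 0)]" "[(x, 0), (y, width_out x + m)]" s i t]
    path_shift_mono[of "[(x, 0), (y, width_out x + m)]" "[(y, width_in x + m), (x, 0)]" s i t]
    exchange_path_0
  by (auto simp: add.assoc simp del: path_Cons_iff)

text \<open>
  Local replacement, directed so that every orientation of the left fragment extends to the right one.
  Isotopy itself requires both diagrams to be consistently oriented, so it is not a local relation.
\<close>

definition reduces_to :: "bool diagram \<Rightarrow> bool diagram \<Rightarrow> bool" where
  "reduces_to x y \<longleftrightarrow> (\<forall>u v. link_diagram (u @ x @ v) \<longrightarrow> isotopic (u @ x @ v) (u @ y @ v))"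

lemma isotopic_link_diagram: "isotopic D E \<Longrightarrow> link_diagram D \<and> link_diagram E"
  by (induction rule: isotopic.induct) auto

lemma reduces_to_refl [simp]: "reduces_to x x"
  by (simp add: reduces_to_def isotopic.refl)

lemma reduces_to_trans [trans]: "reduces_to x y \<Longrightarrow> reduces_to y z \<Longrightarrow> reduces_to x z"
  unfolding reduces_to_def by (meson isotopic.trans isotopic_link_diagram)

lemma reduces_to_context: "reduces_to x y \<Longrightarrow> reduces_to (u @ x @ v) (u @ y @ v)"
  unfolding reduces_to_def
proof (intro allI impI)
  fix u' v'
  assume *: "\<forall>u v. link_diagram (u @ x @ v) \<longrightarrow> isotopic (u @ x @ v) (u @ y @ v)"
    and "link_diagram (u' @ (u @ x @ v) @ v')"
  then show "isotopic (u' @ (u @ x @ v) @ v') (u' @ (u @ y @ v) @ v')"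
    using *[rule_format, of "u' @ u" "v @ v'"] by simp
qed

lemma reduces_to_isotopic: "reduces_to x y \<Longrightarrow> link_diagram x \<Longrightarrow> isotopic x y"
  unfolding reduces_to_def by (metis append.left_neutral append.right_neutral)

lemma reduces_to_if_isotopic:
  assumes "\<And>u v. link_diagram (u @ x @ v) \<Longrightarrow> link_diagram (u @ y @ v) \<Longrightarrow> isotopic (u @ x @ v) (u @ y @ v)"
    and "\<And>s t. path s x t \<Longrightarrow> path s y t"
  shows "reduces_to x y"
  unfolding reduces_to_def
proof (intro allI impI)
  fix u v assume *: "link_diagram (u @ x @ v)"
  then have "link_diagram (u @ y @ v)"
    using assms(2) unfolding link_diagram_def path_append_iff by blast
  with * show "isotopic (u @ x @ v) (u @ y @ v)" by (rule assms(1))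
qed

lemma reduces_to_move: "move x y \<Longrightarrow> (\<And>s t. path s x t \<Longrightarrow> path s y t) \<Longrightarrow> reduces_to x y"
  by (rule reduces_to_if_isotopic) (auto intro: isotopic.move)

lemma reduces_to_move_rev: "move y x \<Longrightarrow> (\<And>s t. path s x t \<Longrightarrow> path s y t) \<Longrightarrow> reduces_to x y"
  by (rule reduces_to_if_isotopic) (auto intro: isotopic.move isotopic.sym)

lemma reduces_to_exchange:
  "j = i + width_in x + m \<Longrightarrow> k = i + width_out x + m \<Longrightarrow>
    reduces_to [(y, j), (x, i)] [(x, i), (y, k)]"
  using exchange_path by (auto intro!: reduces_to_move move.exchange simp del: path_Cons_iff)

lemma reduces_to_exchange_rev:
  "j = i + width_in x + m \<Longrightarrow> k = i + width_out x + m \<Longrightarrow>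
    reduces_to [(x, i), (y, k)] [(y, j), (x, i)]"
  using exchange_path by (auto intro!: reduces_to_move_rev move.exchange simp del: path_Cons_iff)

lemma reduces_to_shift:
  assumes "\<And>s t. path s x t \<Longrightarrow> path s y t" "x \<noteq> []"
    and "move (shift i x) (shift i y) \<or> move (shift i y) (shift i x)"
  shows "reduces_to (shift i x) (shift i y)"
  using path_shift_mono[OF assms(1,2), where i = i] assms(3) reduces_to_move reduces_to_move_rev by blast

section \<open>The generating moves as directed replacements\<close>

lemma reduces_to_zigzag_left: "reduces_to [(Cup d, i), (Cap, Suc i)] []"
proof -
  have "path s [(Cup d, 0), (Cap, 1)] t \<Longrightarrow> path s [] t" for s t
    by auto
  then show ?thesis
    using reduces_to_shift[of "[(Cup d, 0), (Cap, 1)]" "[]" i] move.zigzag_left[of d i]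
    by (simp del: path_Cons_iff)
qed

lemma reduces_to_zigzag_right: "reduces_to [(Cup d, Suc i), (Cap, i)] []"
proof -
  have "path s [(Cup d, 1), (Cap, 0)] t \<Longrightarrow> path s [] t" for s t
    by auto
  then show ?thesis
    using reduces_to_shift[of "[(Cup d, 1), (Cap, 0)]" "[]" i] move.zigzag_right[of d i]
    by (simp del: path_Cons_iff)
qed

lemma reduces_to_slide_cup: "reduces_to [(Cup d, Suc i), (Cross k, i)] [(Cup d, i), (Cross (\<not> k), Suc i)]"
proof -
  have "path s [(Cup d, 1), (Cross k, 0)] t \<Longrightarrow> path s [(Cup d, 0), (Cross (\<not> k), 1)] t" for s t
    by auto
  then show ?thesis
    using reduces_to_shift[of "[(Cup d, 1), (Cross k, 0)]" "[(Cup d, 0), (Cross (\<not> k), 1)]" i] move.slide_cup[of d i "\<not> k"]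
    by (simp del: path_Cons_iff)
qed

lemma reduces_to_slide_cap: "reduces_to [(Cross k, Suc i), (Cap, i)] [(Cross (\<not> k), i), (Cap, Suc i)]"
proof -
  have "path s [(Cross k, 1), (Cap, 0)] t \<Longrightarrow> path s [(Cross (\<not> k), 0), (Cap, 1)] t" for s t
    by auto
  then show ?thesis
    using reduces_to_shift[of "[(Cross k, 1), (Cap, 0)]" "[(Cross (\<not> k), 0), (Cap, 1)]" i] move.slide_cap[of "\<not> k" i]
    by (simp del: path_Cons_iff)
qed

text \<open>The crossing interchanges the two legs, so removing it reverses the label of the
  cup.\<close>

lemma reduces_to_R1_cup: "reduces_to [(Cup d, i), (Cross k, i)] [(Cup (\<not> d), i)]"
proof -
  have "path s [(Cup d, 0), (Cross k, 0)] t \<Longrightarrow> path s [(Cup (\<not> d), 0)] t" for s t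
    by auto
  then show ?thesis
    using reduces_to_shift[of "[(Cup d, 0), (Cross k, 0)]" "[(Cup (\<not> d), 0)]" i] move.R1_cup[of d i k]
    by (simp del: path_Cons_iff)
qed

lemma reduces_to_R1_cap: "reduces_to [(Cross k, i), (Cap, i)] [(Cap, i)]"
proof -
  have "path s [(Cross k, 0), (Cap, 0)] t \<Longrightarrow> path s [(Cap, 0)] t" for s t
    by auto
  then show ?thesis
    using reduces_to_shift[of "[(Cross k, 0), (Cap, 0)]" "[(Cap, 0)]" i] move.R1_cap[of k i]
    by (simp del: path_Cons_iff)
qed

lemma reduces_to_R2: "reduces_to [(Cross k, i), (Cross (\<not> k), i)] []"
proof -
  have "path s [(Cross k, 0), (Cross (\<not> k), 0)] t \<Longrightarrow> path s [] t" for s t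
    by auto
  then show ?thesis
    using reduces_to_shift[of "[(Cross k, 0), (Cross (\<not> k), 0)]" "[]" i] move.R2[of k i]
    by (simp del: path_Cons_iff)
qed

text \<open>A crossing keeps the number of strands, so a piece to the right of all crossings of
  \<open>D\<close> moves past them without a change of position.\<close>

lemma reduces_to_cross_right:
  "\<forall>(x, i) \<in> set D. (\<exists>k. x = Cross k) \<and> i + 2 \<le> j \<Longrightarrow> reduces_to ((y, j) # D) (D @ [(y, j)])"
proof (induction D)
  case (Cons c D)
  then obtain k i where c: "c = (Cross k, i)" "i + 2 \<le> j" by auto
  have "reduces_to [(y, j), (Cross k, i)] [(Cross k, i), (y, j)]"
    using c(2) by (intro reduces_to_exchange[where m = "j - (i + 2)"]) auto
  from reduces_to_context[OF this, of "[]" D]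
  have "reduces_to ((y, j) # c # D) (c # (y, j) # D)" by (simp add: c)
  also have "reduces_to \<dots> (c # D @ [(y, j)])"
    using reduces_to_context[OF Cons.IH, of "[c]" "[]"] Cons.prems by simp
  finally show ?case by simp
qed simp

lemma reduces_to_cross_left:
  "\<forall>(x, i) \<in> set D. (\<exists>k. x = Cross k) \<and> i + 2 \<le> j \<Longrightarrow> reduces_to (D @ [(y, j)]) ((y, j) # D)"
proof (induction D)
  case (Cons c D)
  then obtain k i where c: "c = (Cross k, i)" "i + 2 \<le> j" by auto
  have "reduces_to (c # D @ [(y, j)]) (c # (y, j) # D)"
    using reduces_to_context[OF Cons.IH, of "[c]" "[]"] Cons.prems by simp
  also have "reduces_to [(Cross k, i), (y, j)] [(y, j), (Cross k, i)]"
    using c(2) by (intro reduces_to_exchange_rev[where m = "j - (i + 2)"]) auto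
  from reduces_to_context[OF this, of "[]" D]
  have "reduces_to (c # (y, j) # D) ((y, j) # c # D)" by (simp add: c)
  finally show ?case by simp
qed simp

text \<open>Below the cup its two legs are absent, so a column to their right sits two positions
  further left.\<close>

lemma reduces_to_cup_crosses:
  "reduces_to ((Cup d, i) # replicate q (Cross k, i + 2)) (replicate q (Cross k, i) @ [(Cup d, i)])"
proof (induction q)
  case (Suc q)
  have "reduces_to [(Cup d, i), (Cross k, i + 2)] [(Cross k, i), (Cup d, i)]"
    by (rule reduces_to_exchange_rev[where m = 0]) auto
  from reduces_to_context[OF this, of "[]" "replicate q (Cross k, i + 2)"]
  have "reduces_to ((Cup d, i) # replicate (Suc q) (Cross k, i + 2))
      ((Cross k, i) # (Cup d, i) # replicate q (Cross k, i + 2))" by simp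
  also have "reduces_to \<dots> ((Cross k, i) # replicate q (Cross k, i) @ [(Cup d, i)])"
    using reduces_to_context[OF Suc, of "[(Cross k, i)]" "[]"] by simp
  finally show ?case by simp
qed simp

lemma reduces_to_kinks_cup:
  "\<exists>d'. reduces_to ((Cup d, i) # replicate q (Cross k, i)) [(Cup d', i)]"
proof (induction q arbitrary: d)
  case 0
  then show ?case by (auto intro: reduces_to_refl)
next
  case (Suc q)
  from Suc[of "\<not> d"] obtain d'
    where d': "reduces_to ((Cup (\<not> d), i) # replicate q (Cross k, i)) [(Cup d', i)]" by blast
  have "reduces_to ((Cup d, i) # replicate (Suc q) (Cross k, i)) ((Cup (\<not> d), i) # replicate q (Cross k, i))"
    using reduces_to_context[OF reduces_to_R1_cup, of "[]" d i k "replicate q (Cross k, i)"] by simp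
  also note d'
  finally show ?case by blast
qed

lemma reduces_to_kinks_cap: "reduces_to (replicate q (Cross k, i) @ [(Cap, i)]) [(Cap, i)]"
proof (induction q)
  case (Suc q)
  have "reduces_to (replicate (Suc q) (Cross k, i) @ [(Cap, i)]) ([(Cross k, i), (Cap, i)])"
    using reduces_to_context[OF Suc, of "[(Cross k, i)]" "[]"] by simp
  also note reduces_to_R1_cap
  finally show ?case .
qed simp

text \<open>A second Reidemeister move turned sideways: sliding one crossing over the cup and the
  other over the cap brings both to position \<open>Suc i\<close>, with opposite values of
  \<open>Cross\<close>, where they cancel.\<close>

lemma reduces_to_unclasp:
  "reduces_to [(Cup d, Suc i), (Cross k, i), (Cross (\<not> k), Suc (Suc i)), (Cap, Suc i)] [(Cap, i), (Cup d, i)]"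
proof -
  have "reduces_to [(Cup d, Suc i), (Cross k, i), (Cross (\<not> k), Suc (Suc i)), (Cap, Suc i)]
      [(Cup d, i), (Cross (\<not> k), Suc i), (Cross (\<not> k), Suc (Suc i)), (Cap, Suc i)]"
    using reduces_to_context[OF reduces_to_slide_cup, of "[]"] by simp
  also have "reduces_to \<dots> [(Cup d, i), (Cross (\<not> k), Suc i), (Cross k, Suc i), (Cap, Suc (Suc i))]"
    using reduces_to_context[OF reduces_to_slide_cap, of "[(Cup d, i), (Cross (\<not> k), Suc i)]" "\<not> k" "Suc i" "[]"] by simp
  also have "reduces_to \<dots> [(Cup d, i), (Cap, Suc (Suc i))]"
    using reduces_to_context[OF reduces_to_R2, of "[(Cup d, i)]" "\<not> k" "Suc i"] by simp
  also have "reduces_to \<dots> [(Cap, i), (Cup d, i)]"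
    by (rule reduces_to_exchange_rev[where m = 0]) auto
  finally show ?thesis .
qed

section \<open>Pretzel diagrams\<close>

text \<open>The labels are left free because every orientation of a pretzel diagram starts with such
  a row of cups. The labels that extend to the caps are found in the last section.\<close>

definition bottom :: "bool \<Rightarrow> bool list \<Rightarrow> bool diagram" where
  "bottom d es = (Cup d, 0) # map (\<lambda>j. (Cup (es ! j), 2 * j + 1)) [0..<length es]"

fun caps :: "nat \<Rightarrow> bool diagram" where
  "caps 0 = [(Cap, 0)]"
| "caps (Suc m) = (Cap, 2 * m + 1) # caps m"

definition column :: "nat \<Rightarrow> int \<Rightarrow> bool diagram" where
  "column j p = replicate (nat \<bar>p\<bar>) (Cross (p > 0), 2 * j)"

fun columns :: "nat \<Rightarrow> int list \<Rightarrow> bool diagram" where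
  "columns j [] = []"
| "columns j (p # ps) = column j p @ columns (Suc j) ps"

text \<open>
  The labels of the inner cups are those for which both strands of every column are antiparallel,
  with the left one directed as \<open>a\<close>.
\<close>

definition pretzel_diagram :: "bool \<Rightarrow> int list \<Rightarrow> bool diagram" where
  "pretzel_diagram a ps = bottom a (replicate (length ps - 1) (\<not> a)) @ columns 0 ps @ caps (length ps - 1)"

definition legs :: "bool list \<Rightarrow> bool list" where
  "legs es = concat (map (\<lambda>e. [e, \<not> e]) es)"

text \<open>This is the effect on the state of a row of columns with odd numbers of
  crossings.\<close>

fun swap_pairs :: "'a list \<Rightarrow> 'a list" where
  "swap_pairs (x # y # zs) = y # x # swap_pairs zs"
| "swap_pairs zs = zs"

lemma bottom_Nil [simp]: "bottom d [] = [(Cup d, 0)]"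
  by (simp add: bottom_def)

lemma bottom_snoc: "bottom d (es @ [e]) = bottom d es @ [(Cup e, 2 * length es + 1)]"
  by (auto simp: bottom_def nth_append)

lemma bottom_replicate_Suc:
  "bottom d (replicate (Suc m) e) = bottom d (replicate m e) @ [(Cup e, 2 * m + 1)]"
  using bottom_snoc[of d "replicate m e" e] by (simp add: replicate_append_same)

lemma columns_append: "columns j (ps @ qs) = columns j ps @ columns (j + length ps) qs"
  by (induction ps arbitrary: j) auto

lemma columns_crosses:
  "(x, i) \<in> set (columns j ps) \<Longrightarrow> (\<exists>k. x = Cross k) \<and> i + 2 \<le> 2 * (j + length ps)"
  by (induction ps arbitrary: j) (fastforce simp: column_def)+

lemma legs_simps [simp]:
  "legs [] = []" "legs (e # es) = e # (\<not> e) # legs es" "legs (es @ fs) = legs es @ legs fs"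
  by (simp_all add: legs_def)

lemma length_legs [simp]: "length (legs es) = 2 * length es"
  by (induction es) auto

text \<open>One alternating state read in two ways: grouped by the arcs, with the outer arc around
  the inner ones, and grouped by the columns.\<close>

lemma legs_rotate: "a # legs (replicate m (\<not> a)) @ [\<not> a] = legs (replicate (Suc m) a)"
  by (induction m) auto

lemma swap_pairs_legs: "swap_pairs (legs (replicate m a)) = legs (replicate m (\<not> a))"
  by (induction m) auto

lemma path_bottom: "path [] (bottom d es) (d # legs es @ [\<not> d])"
proof (induction es rule: rev_induct)
  case (snoc e es)
  have "piece_path ((d # legs es) @ [\<not> d]) (Cup e, 2 * length es + 1)
      ((d # legs es) @ [e, \<not> e] @ [\<not> d])"
    by (rule piece_path.Cup) simp
  with snoc show ?case by (auto simp: bottom_snoc)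
qed simp

lemma path_crosses:
  "length l = i \<Longrightarrow>
    path (l @ x # y # r) (replicate m (Cross k, i)) (l @ (if odd m then y # x # r else x # y # r))"
proof (induction m arbitrary: x y)
  case (Suc m)
  have "piece_path (l @ x # y # r) (Cross k, i) (l @ y # x # r)"
    using piece_path.Cross[of l i x y r k] Suc.prems by simp
  with Suc.IH[of y x] Suc.prems show ?case by auto
qed simp

lemma path_columns:
  "length l = 2 * j \<Longrightarrow> length s = 2 * length ps \<Longrightarrow> \<forall>p \<in> set ps. odd p \<Longrightarrow>
    path (l @ s @ r) (columns j ps) (l @ swap_pairs s @ r)"
proof (induction ps arbitrary: l s j)
  case (Cons p ps)
  then obtain x y s' where s: "s = x # y # s'" "length s' = 2 * length ps"
    by (auto simp: length_Suc_conv)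
  have "odd (nat \<bar>p\<bar>)" using Cons.prems(3) by (simp add: even_nat_iff)
  then have "path (l @ s @ r) (column j p) ((l @ [y, x]) @ s' @ r)"
    using path_crosses[of l "2 * j" x y "s' @ r" "nat \<bar>p\<bar>"] Cons.prems(1) by (simp add: column_def s)
  moreover have "path ((l @ [y, x]) @ s' @ r) (columns (Suc j) ps) ((l @ [y, x]) @ swap_pairs s' @ r)"
    using Cons.prems s(2) by (intro Cons.IH) auto
  ultimately show ?case by (auto simp: s)
qed simp

text \<open>The equivalence serves twice: from right to left to orient the standard diagram, and
  from left to right to exclude other orientations.\<close>

lemma path_caps_iff: "path t (caps m) [] \<longleftrightarrow> (\<exists>b fs. length fs = m \<and> t = b # legs fs @ [\<not> b])"
proof (induction m arbitrary: t)
  case (Suc m)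
  have "piece_path t (Cap, 2 * m + 1) (b # legs fs @ [\<not> b]) \<longleftrightarrow>
      (\<exists>d. t = b # legs (fs @ [d]) @ [\<not> b])" if "length fs = m" for b fs
  proof
    assume "piece_path t (Cap, 2 * m + 1) (b # legs fs @ [\<not> b])"
    then show "\<exists>d. t = b # legs (fs @ [d]) @ [\<not> b]"
    proof cases
      case (Cap l d r)
      have "(b # legs fs) @ [\<not> b] = l @ r" "length (b # legs fs) = length l"
        using Cap that by auto
      then have "b # legs fs = l \<and> [\<not> b] = r" by (metis append_eq_append_conv)
      with Cap show ?thesis by auto
    qed
  next
    assume "\<exists>d. t = b # legs (fs @ [d]) @ [\<not> b]"
    then show "piece_path t (Cap, 2 * m + 1) (b # legs fs @ [\<not> b])"
      using piece_path.Cap[of "b # legs fs" "2 * m + 1" _ "[\<not> b]"] that by auto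
  qed
  then have "path t (caps (Suc m)) [] \<longleftrightarrow> (\<exists>b fs d. length fs = m \<and> t = b # legs (fs @ [d]) @ [\<not> b])"
    by (auto simp: Suc simp del: legs_simps) metis+
  also have "\<dots> \<longleftrightarrow> (\<exists>b fs. length fs = Suc m \<and> t = b # legs fs @ [\<not> b])"
    by (metis length_Suc_conv_rev)
  finally show ?case .
qed auto

text \<open>The columns see \<open>a\<close> on the left of each pair and reverse every pair. The
  result, regrouped by arcs with \<open>legs_rotate\<close>, is a state that the caps can
  close.\<close>

lemma link_diagram_pretzel:
  assumes "\<forall>p \<in> set ps. odd p" "ps \<noteq> []"
  shows "link_diagram (pretzel_diagram a ps)"
proof -
  define m where "m = length ps - 1"
  have m: "length ps = Suc m" using assms(2) by (cases ps) (auto simp: m_def)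
  have "path [] (bottom a (replicate m (\<not> a))) (legs (replicate (Suc m) a))"
    using path_bottom[of a "replicate m (\<not> a)"] by (simp only: legs_rotate)
  moreover have "path (legs (replicate (Suc m) a)) (columns 0 ps) (legs (replicate (Suc m) (\<not> a)))"
    using path_columns[of "[]" 0 "legs (replicate (Suc m) a)" ps "[]"] assms(1) m
    by (simp only: swap_pairs_legs) simp
  moreover have "path (legs (replicate (Suc m) (\<not> a))) (caps m) []"
    unfolding path_caps_iff legs_rotate[where a = "\<not> a", symmetric]
    by (intro exI[of _ "\<not> a"] exI[of _ "replicate m (\<not> \<not> a)"]) simp
  ultimately show ?thesis unfolding link_diagram_def pretzel_diagram_def m_def[symmetric] path_append_iff
    by blast
qed

text \<open>Write e_1, ..., e_m for the entries of \<open>es\<close>. The swapped state fits the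
  arcs only if y = e_1, e_2 = \<open>\<not> x\<close>, e_(j+2) = e_j and e_(m-1) = z. As m is even,
  m - 1 is odd, so the labels with odd index equal z as well as those with even index. For m = 0 one
  reads off y = z.\<close>

lemma alternating_if_capped:
  assumes "swap_pairs (x # legs es @ [z]) = y # legs fs @ [w]"
    "length es = length fs" "even (length es)" "z = (\<not> x)"
  shows "y = z \<and> es = replicate (length es) z"
  using assms
proof (induction es arbitrary: fs rule: induct_list012)
  case 1
  then show ?case by (cases y) auto
next
  case (3 e1 e2 es)
  then obtain f1 f2 fs' where "fs = f1 # f2 # fs'"
    by (metis Suc_length_conv)
  with "3.prems" have eqs: "e1 = y" "e2 = (\<not> x)"
    and rest: "swap_pairs (x # legs es @ [z]) = y # legs fs' @ [w]" "length es = length fs'" "even (length es)"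
    by auto
  from "3.IH"(1)[OF rest \<open>z = (\<not> x)\<close>] eqs \<open>z = (\<not> x)\<close> show ?case by simp
qed auto

text \<open>The cap of the cut column is moved down past the other columns and straightens against
  the last inner cup; the cup straightens against the last inner cap. If \<open>xs\<close> were
  empty, the diagram would consist of two circles instead.\<close>

lemma reduces_to_cut_last:
  assumes "xs \<noteq> []"
  shows "reduces_to (bottom a (replicate (length xs) (\<not> a)) @ columns 0 xs
      @ [(Cap, 2 * length xs), (Cup d, 2 * length xs)] @ caps (length xs)) (pretzel_diagram a xs)"
proof -
  obtain m where m: "length xs = Suc m" using assms by (cases xs) auto
  let ?B = "bottom a (replicate m (\<not> a))"
  let ?c = "(Cup (\<not> a), 2 * m + 1)"
  let ?T = "(Cup d, Suc (2 * m + 1)) # (Cap, 2 * m + 1) # caps m"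
  have "reduces_to (?B @ [?c] @ (columns 0 xs @ [(Cap, Suc (2 * m + 1))]) @ ?T)
      (?B @ [?c] @ ((Cap, Suc (2 * m + 1)) # columns 0 xs) @ ?T)"
    by (subst (1 2) append_assoc[symmetric], rule reduces_to_context, rule reduces_to_cross_left)
      (auto dest!: columns_crosses simp: m)
  also have "reduces_to \<dots> (?B @ columns 0 xs @ ?T)"
    using reduces_to_context[OF reduces_to_zigzag_left, of ?B "\<not> a" "2 * m + 1" "columns 0 xs @ ?T"]
    by simp
  also have "reduces_to \<dots> (?B @ columns 0 xs @ caps m)"
    using reduces_to_context[OF reduces_to_zigzag_right, of "?B @ columns 0 xs" d "2 * m + 1" "caps m"]
    by simp
  finally show ?thesis by (simp add: m bottom_replicate_Suc pretzel_diagram_def del: replicate_Suc)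
qed

text \<open>The last inner cup is raised past \<open>xs\<close> and straightens against the cap of
  the cut column. Then the column \<open>q\<close> is moved below the remaining cup, into the place
  of the cut column, and this cup straightens against the last inner cap.\<close>

lemma reduces_to_cut_butlast:
  "reduces_to (bottom a (replicate (Suc (length xs)) (\<not> a)) @ columns 0 xs
      @ [(Cap, 2 * length xs), (Cup d, 2 * length xs)] @ columns (Suc (length xs)) [q]
      @ caps (Suc (length xs))) (pretzel_diagram a (xs @ [q]))"
proof -
  define i where "i = 2 * length xs"
  let ?B = "bottom a (replicate (length xs) (\<not> a))"
  let ?c = "(Cup (\<not> a), Suc i)"
  let ?X = "columns 0 xs"
  let ?Q = "\<lambda>i. replicate (nat \<bar>q\<bar>) (Cross (q > 0), i)"
  let ?T = "caps (length xs)"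
  have "reduces_to (?B @ (?c # ?X) @ [(Cap, i), (Cup d, i)] @ ?Q (i + 2) @ [(Cap, Suc i)] @ ?T)
      (?B @ (?X @ [?c]) @ [(Cap, i), (Cup d, i)] @ ?Q (i + 2) @ [(Cap, Suc i)] @ ?T)"
    by (rule reduces_to_context, rule reduces_to_cross_right) (auto dest!: columns_crosses simp: i_def)
  also have "reduces_to \<dots> (?B @ ?X @ ((Cup d, i) # ?Q (i + 2)) @ [(Cap, Suc i)] @ ?T)"
    using reduces_to_context[OF reduces_to_zigzag_right, of "?B @ ?X" "\<not> a" i
        "((Cup d, i) # ?Q (i + 2)) @ [(Cap, Suc i)] @ ?T"] by simp
  also have "reduces_to \<dots> (?B @ ?X @ (?Q i @ [(Cup d, i)]) @ [(Cap, Suc i)] @ ?T)"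
    using reduces_to_context[OF reduces_to_cup_crosses, of "?B @ ?X" d i _ _ "[(Cap, Suc i)] @ ?T"] by simp
  also have "reduces_to \<dots> (?B @ ?X @ ?Q i @ ?T)"
    using reduces_to_context[OF reduces_to_zigzag_left, of "?B @ ?X @ ?Q i" d i "?T"] by simp
  finally show ?thesis
    by (simp add: bottom_replicate_Suc pretzel_diagram_def column_def i_def columns_append del: replicate_Suc)
qed

text \<open>Unclasping the two columns leaves a cap below a cup, which is exactly the picture of a
  cut last column.\<close>

lemma reduces_to_cancel_columns:
  assumes "qs \<noteq> []"
  shows "reduces_to (pretzel_diagram a (qs @ [1, -1])) (pretzel_diagram a qs)"
proof -
  define i where "i = 2 * length qs"
  let ?B = "bottom a (replicate (length qs) (\<not> a))"
  let ?c = "(Cup (\<not> a), Suc i)"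
  let ?X = "columns 0 qs"
  let ?T = "caps (length qs)"
  let ?Q = "[(Cross True, i), (Cross (\<not> True), Suc (Suc i)), (Cap, Suc i)]"
  have "reduces_to (?B @ (?c # ?X) @ ?Q @ ?T) (?B @ (?X @ [?c]) @ ?Q @ ?T)"
    by (rule reduces_to_context, rule reduces_to_cross_right) (auto dest!: columns_crosses simp: i_def)
  also have "reduces_to \<dots> (?B @ ?X @ [(Cap, i), (Cup (\<not> a), i)] @ ?T)"
    using reduces_to_context[OF reduces_to_unclasp, of "?B @ ?X" "\<not> a" i True "?T"] by simp
  also have "reduces_to \<dots> (pretzel_diagram a qs)"
    using reduces_to_cut_last[OF assms, of a "\<not> a"] by (simp add: i_def)
  finally show ?thesis
    by (simp add: bottom_replicate_Suc pretzel_diagram_def[of a "qs @ [1, -1]"] column_def i_def columns_append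
        replicate_Suc[of 0] del: replicate_Suc)
qed

lemma reduces_to_link_diagram: "reduces_to x y \<Longrightarrow> link_diagram x \<Longrightarrow> link_diagram y"
  using isotopic_link_diagram reduces_to_isotopic by blast

section \<open>The skein recursion\<close>

lemma conway_reduces_to: "conway_polynomial C \<Longrightarrow> reduces_to x y \<Longrightarrow> link_diagram x \<Longrightarrow> C x = C y"
  unfolding conway_polynomial_def using reduces_to_isotopic by blast

text \<open>The last two conclusions supply the consistent orientations without which
  \<open>reduces_to\<close> cannot be applied to the members of the triple.\<close>

lemma conway_skein:
  assumes "conway_polynomial C"
    and u: "path [] u (l @ [a, \<not> a] @ r)" and v: "path (l @ [\<not> a, a] @ r) v []" and i: "length l = i"
  shows "C (u @ [(Cross False, i)] @ v) - C (u @ [(Cross True, i)] @ v)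
      = [:0, 1:] * C (u @ [(Cap, i), (Cup (\<not> a), i)] @ v)"
    and "link_diagram (u @ [(Cross k, i)] @ v)"
    and "link_diagram (u @ [(Cap, i), (Cup (\<not> a), i)] @ v)"
proof -
  show "C (u @ [(Cross False, i)] @ v) - C (u @ [(Cross True, i)] @ v)
      = [:0, 1:] * C (u @ [(Cap, i), (Cup (\<not> a), i)] @ v)"
    using assms(1) skein_triple.antiparallel[OF u v i] unfolding conway_polynomial_def by blast
  have "path (l @ [a, \<not> a] @ r) [(Cross k, i)] (l @ [\<not> a, a] @ r)"
    using piece_path.Cross[OF i] by auto
  with u v show "link_diagram (u @ [(Cross k, i)] @ v)"
    unfolding link_diagram_def path_append_iff by blast
  have "path (l @ [a, \<not> a] @ r) [(Cap, i), (Cup (\<not> a), i)] (l @ [\<not> a, a] @ r)"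
    using piece_path.Cap[OF i, of a r] piece_path.Cup[OF i, of r "\<not> a"] by auto
  with u v show "link_diagram (u @ [(Cap, i), (Cup (\<not> a), i)] @ v)"
    unfolding link_diagram_def path_append_iff by blast
qed

text \<open>The crossing to be changed is followed by p - 1 crossings \<open>Cross True\<close> if p
  is positive and by |p| + 1 crossings \<open>Cross False\<close> if p is negative; an opposite pair
  cancels where it occurs. Since p is odd, the number \<open>m\<close> of these is even.\<close>

lemma crossing_change_column:
  assumes "odd p"
  obtains m k where "even m"
    "reduces_to ((Cross False, 2 * j) # replicate m (Cross k, 2 * j)) (column j (p - 2))"
    "reduces_to ((Cross True, 2 * j) # replicate m (Cross k, 2 * j)) (column j p)"
proof -
  have R2: "reduces_to ((Cross (\<not> k), 2 * j) # replicate (Suc q) (Cross k, 2 * j))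
      (replicate q (Cross k, 2 * j))" for k q
    using reduces_to_context[OF reduces_to_R2[of "\<not> k" "2 * j"], of "[]" "replicate q (Cross k, 2 * j)"]
    by simp
  consider "p = 1" | "p \<ge> 3" | "p < 0" using assms by (cases "p = 2"; cases "p = 0") force+
  then show ?thesis
  proof cases
    case 1
    then show ?thesis using that[of 0 True] by (simp add: column_def)
  next
    case 2
    define q where "q = nat (p - 2)"
    have p: "p = int q + 2" and q: "q > 0" using 2 by (auto simp: q_def)
    have "nat p = Suc (Suc q)" using p by simp
    with q show ?thesis
      using that[of "Suc q" True] R2[of True q] assms by (simp add: column_def p)
  next
    case 3
    define q where "q = nat (- p)"
    have p: "p = - int q" and q: "q > 0" using 3 by (auto simp: q_def)
    have "nat (2 + int q) = Suc (Suc q)" by simp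
    with q show ?thesis
      using that[of "Suc q" False] R2[of False q] assms by (simp add: column_def p)
  qed
qed

lemma conway_pretzel_skein:
  assumes C: "conway_polynomial C" and odd: "\<forall>x \<in> set (xs @ [p] @ ys). odd x"
  defines "N \<equiv> length xs + length ys"
  obtains d where "C (pretzel_diagram a (xs @ [p - 2] @ ys)) - C (pretzel_diagram a (xs @ [p] @ ys))
      = [:0, 1:] * C (bottom a (replicate N (\<not> a)) @ columns 0 xs
          @ [(Cap, 2 * length xs), (Cup d, 2 * length xs)] @ columns (Suc (length xs)) ys @ caps N)"
    "link_diagram (bottom a (replicate N (\<not> a)) @ columns 0 xs
          @ [(Cap, 2 * length xs), (Cup d, 2 * length xs)] @ columns (Suc (length xs)) ys @ caps N)"
proof -
  define i where "i = 2 * length xs"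
  define u where "u = bottom a (replicate N (\<not> a)) @ columns 0 xs"
  define w where "w = columns (Suc (length xs)) ys @ caps N"
  define l where "l = legs (replicate (length xs) (\<not> a))"
  define r where "r = legs (replicate (length ys) a)"
  have pretzel: "pretzel_diagram a (xs @ [x] @ ys) = u @ column (length xs) x @ w" for x
    by (simp add: pretzel_diagram_def u_def w_def N_def columns_append)
  have l: "length l = i" by (simp add: l_def i_def)
  have "replicate (Suc N) a = replicate (length xs) a @ [a] @ replicate (length ys) a"
    by (simp add: N_def replicate_add replicate_app_Cons_same)
  then have "path [] (bottom a (replicate N (\<not> a))) ([] @ legs (replicate (length xs) a) @ [a, \<not> a] @ r)"
    using path_bottom[of a "replicate N (\<not> a)"] unfolding legs_rotate by (simp add: r_def)
  moreover have "path ([] @ legs (replicate (length xs) a) @ [a, \<not> a] @ r) (columns 0 xs) ([] @ l @ [a, \<not> a] @ r)"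
    unfolding l_def swap_pairs_legs[symmetric] using odd by (intro path_columns) auto
  ultimately have path_u: "path [] u (l @ [a, \<not> a] @ r)"
    unfolding u_def path_append_iff by (metis append_Nil)
  have "odd (nat \<bar>p\<bar>)" using odd by (simp add: even_nat_iff)
  then have "path (l @ [a, \<not> a] @ r) (column (length xs) p) (l @ [\<not> a, a] @ r)"
    using path_crosses[OF l, of a "\<not> a" r "nat \<bar>p\<bar>"] by (simp add: column_def i_def)
  \<comment> \<open>The upper part \<open>w\<close> needs no computation of its own: the whole
    pretzel diagram is oriented, and the state entering \<open>w\<close> is determined by what lies
    below.\<close>
  moreover have "link_diagram (u @ column (length xs) p @ w)"
    using link_diagram_pretzel[OF odd] by (simp add: pretzel[symmetric])
  ultimately have path_w: "path (l @ [\<not> a, a] @ r) w []"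
    using path_u unfolding link_diagram_def path_append_iff by (metis path_functional)
  from odd have "odd p" by simp
  then obtain m k where m: "even m"
    "reduces_to ((Cross False, i) # replicate m (Cross k, i)) (column (length xs) (p - 2))"
    "reduces_to ((Cross True, i) # replicate m (Cross k, i)) (column (length xs) p)"
    unfolding i_def by (rule crossing_change_column)
  define v where "v = replicate m (Cross k, i) @ w"
  \<comment> \<open>As \<open>m\<close> is even, the additional crossings do not alter the
    state.\<close>
  have path_v: "path (l @ [\<not> a, a] @ r) v []"
    using path_crosses[OF l, of "\<not> a" a r m k] m(1) path_w unfolding v_def path_append_iff by auto
  note skein = conway_skein[OF C path_u path_v l]
  have "C (u @ [(Cross False, i)] @ v) = C (pretzel_diagram a (xs @ [p - 2] @ ys))"
    unfolding pretzel using conway_reduces_to[OF C reduces_to_context[OF m(2), of u w]] skein(2)[of False]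
    by (simp add: v_def)
  moreover have "C (u @ [(Cross True, i)] @ v) = C (pretzel_diagram a (xs @ [p] @ ys))"
    unfolding pretzel using conway_reduces_to[OF C reduces_to_context[OF m(3), of u w]] skein(2)[of True]
    by (simp add: v_def)
  \<comment> \<open>In the smoothing the additional crossings lie directly above the new cup, so
    they are kinks.\<close>
  moreover obtain d where d: "reduces_to ((Cup (\<not> a), i) # replicate m (Cross k, i)) [(Cup d, i)]"
    using reduces_to_kinks_cup by blast
  have smooth: "reduces_to (u @ [(Cap, i), (Cup (\<not> a), i)] @ v) (u @ [(Cap, i), (Cup d, i)] @ w)"
    using reduces_to_context[OF d, of "u @ [(Cap, i)]" w] by (simp add: v_def)
  ultimately show ?thesis
    using that[of d] skein(1) conway_reduces_to[OF C smooth skein(3)]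
      reduces_to_link_diagram[OF smooth skein(3)]
    by (simp add: u_def w_def i_def)
qed

lemma conway_pretzel_last:
  assumes C: "conway_polynomial C" and "\<forall>x \<in> set (xs @ [p]). odd x" "xs \<noteq> []"
  shows "C (pretzel_diagram a (xs @ [p - 2])) - C (pretzel_diagram a (xs @ [p]))
      = [:0, 1:] * C (pretzel_diagram a xs)"
proof -
  from assms(2) have "\<forall>x \<in> set (xs @ [p] @ []). odd x" by simp
  from conway_pretzel_skein[OF C this, of a] obtain d where
    "C (pretzel_diagram a (xs @ [p - 2])) - C (pretzel_diagram a (xs @ [p]))
      = [:0, 1:] * C (bottom a (replicate (length xs) (\<not> a)) @ columns 0 xs
          @ [(Cap, 2 * length xs), (Cup d, 2 * length xs)] @ caps (length xs))"
    "link_diagram (bottom a (replicate (length xs) (\<not> a)) @ columns 0 xs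
          @ [(Cap, 2 * length xs), (Cup d, 2 * length xs)] @ caps (length xs))"
    by auto
  then show ?thesis using conway_reduces_to[OF C reduces_to_cut_last[OF assms(3)]] by metis
qed

lemma conway_pretzel_butlast:
  assumes C: "conway_polynomial C" and "\<forall>x \<in> set (xs @ [p] @ [q]). odd x"
  shows "C (pretzel_diagram a (xs @ [p - 2, q])) - C (pretzel_diagram a (xs @ [p, q]))
      = [:0, 1:] * C (pretzel_diagram a (xs @ [q]))"
proof -
  from conway_pretzel_skein[OF C assms(2), of a] obtain d where
    "C (pretzel_diagram a (xs @ [p - 2] @ [q])) - C (pretzel_diagram a (xs @ [p] @ [q]))
      = [:0, 1:] * C (bottom a (replicate (Suc (length xs)) (\<not> a)) @ columns 0 xs
          @ [(Cap, 2 * length xs), (Cup d, 2 * length xs)] @ columns (Suc (length xs)) [q] @ caps (Suc (length xs)))"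
    "link_diagram (bottom a (replicate (Suc (length xs)) (\<not> a)) @ columns 0 xs
          @ [(Cap, 2 * length xs), (Cup d, 2 * length xs)] @ columns (Suc (length xs)) [q] @ caps (Suc (length xs)))"
    unfolding list.size add_Suc_right add_0_right plus_1_eq_Suc One_nat_def by metis
  then show ?thesis using conway_reduces_to[OF C reduces_to_cut_butlast] by simp
qed

section \<open>Solution of the recursion and its base cases\<close>

lemma linear_on_odd:
  fixes f :: "int \<Rightarrow> int poly"
  assumes "\<And>p. odd p \<Longrightarrow> f (p - 2) - f p = g"
  shows "f (2 * k + 1) = f 1 - smult k g"
\<comment> \<open>The difference \<open>g\<close> is the same for all odd p, so \<open>f\<close> is
  affine in k. Induction in both directions covers negative entries.\<close>
proof (induction k rule: int_induct[where k = 0])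
  case (step1 i)
  then show ?case using assms[of "2 * (i + 1) + 1"] by (simp add: algebra_simps smult_add_left)
next
  case (step2 i)
  then show ?case using assms[of "2 * i + 1"] by (simp add: algebra_simps smult_diff_left)
qed simp

text \<open>The last column but one is first brought to 1, at the cost of k smoothings that leave
  \<open>qs @ [2 * j + 1]\<close>; then the last one is brought to -1, with smoothings that leave
  \<open>qs @ [1]\<close>.\<close>

lemma conway_pretzel_step:
  fixes k j :: int and a :: bool
  assumes C: "conway_polynomial C" and "\<forall>x \<in> set qs. odd x"
  defines "F \<equiv> \<lambda>ps. C (pretzel_diagram a ps)"
  shows "F (qs @ [2 * k + 1, 2 * j + 1]) = F (qs @ [1, -1])
      - smult (j + 1) ([:0, 1:] * F (qs @ [1])) - smult k ([:0, 1:] * F (qs @ [2 * j + 1]))"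
proof -
  have 1: "F (qs @ [2 * k + 1, 2 * j + 1])
      = F (qs @ [1, 2 * j + 1]) - smult k ([:0, 1:] * F (qs @ [2 * j + 1]))"
    using assms(2) unfolding F_def
    by (intro linear_on_odd[where f = "\<lambda>p. C (pretzel_diagram a (qs @ [p, 2 * j + 1]))"]
        conway_pretzel_butlast[OF C]) auto
  have 2: "F (qs @ [1, 2 * i + 1]) = F (qs @ [1, 1]) - smult i ([:0, 1:] * F (qs @ [1]))" for i
    using assms(2) conway_pretzel_last[OF C, of "qs @ [1]"] unfolding F_def
    by (intro linear_on_odd[where f = "\<lambda>p. C (pretzel_diagram a (qs @ [1, p]))"]) auto
  \<comment> \<open>The entry -1 is 2 * (-1) + 1; it lies one step beyond 1, which accounts for the
    coefficient j + 1 instead of j.\<close>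
  have "F (qs @ [1, -1]) = F (qs @ [1, 1]) + [:0, 1:] * F (qs @ [1])"
    using 2[of "-1"] by (simp del: mult_pCons_left)
  then show ?thesis unfolding 1 2[of j] smult_add_left smult_1_left by simp
qed

text \<open>The normalization concerns the label \<open>True\<close> only. A circle with one kink
  connects both labels: removing the kink at the cap keeps the label, removing it at the cup
  reverses it.\<close>

lemma conway_circle:
  assumes C: "conway_polynomial C"
  shows "C [(Cup d, 0), (Cap, 0)] = 1"
proof -
  have link: "link_diagram [(Cup d, 0), (Cross True, 0), (Cap, 0)]"
    by (auto simp: link_diagram_def)
  have "C [(Cup d, 0), (Cross True, 0), (Cap, 0)] = C [(Cup d, 0), (Cap, 0)]"
    using conway_reduces_to[OF C reduces_to_context[OF reduces_to_R1_cap, of "[(Cup d, 0)]" True 0 "[]"]] link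
    by simp
  moreover have "C [(Cup d, 0), (Cross True, 0), (Cap, 0)] = C [(Cup (\<not> d), 0), (Cap, 0)]"
    using conway_reduces_to[OF C reduces_to_context[OF reduces_to_R1_cup, of "[]" d 0 True "[(Cap, 0)]"]] link
    by simp
  moreover have "C [(Cup True, 0), (Cap, 0)] = 1"
    using C by (simp add: conway_polynomial_def trivial_knot_def)
  ultimately show ?thesis by (cases d) auto
qed

lemma conway_pretzel_singleton:
  assumes C: "conway_polynomial C" and "odd p"
  shows "C (pretzel_diagram a [p]) = 1"
proof -
  have "reduces_to (pretzel_diagram a [p]) [(Cup a, 0), (Cap, 0)]"
    using reduces_to_context[OF reduces_to_kinks_cap, of "[(Cup a, 0)]" _ _ 0 "[]"]
    by (simp add: pretzel_diagram_def column_def)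
  then show ?thesis
    using conway_reduces_to[OF C] link_diagram_pretzel[of "[p]" a] conway_circle[OF C] assms(2) by simp
qed

text \<open>Smoothing the crossing of a once-kinked circle gives two circles. Both choices of the
  crossing give the trivial knot, so z times the value is 0.\<close>

lemma conway_unlink:
  assumes C: "conway_polynomial C"
  shows "C [(Cup a, 0), (Cap, 0), (Cup (\<not> a), 0), (Cap, 0)] = 0"
proof -
  have "C [(Cup a, 0), (Cross k, 0), (Cap, 0)] = 1" for k
    using conway_reduces_to[OF C reduces_to_context[OF reduces_to_R1_cap, of "[(Cup a, 0)]" k 0 "[]"]]
      conway_circle[OF C] by (simp add: link_diagram_def)
  then show ?thesis
    using conway_skein(1)[OF C, of "[(Cup a, 0)]" "[]" a "[]" "[(Cap, 0)]" 0] by simp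
qed

lemma conway_pretzel_cancelling:
  assumes C: "conway_polynomial C" and "\<forall>x \<in> set qs. odd x"
  shows "C (pretzel_diagram a (qs @ [1, -1])) = (if qs = [] then 0 else C (pretzel_diagram a qs))"
proof (cases "qs = []")
  case True
  have "reduces_to (pretzel_diagram a [1, -1]) [(Cup a, 0), (Cap, 0), (Cup (\<not> a), 0), (Cap, 0)]"
    using reduces_to_context[OF reduces_to_unclasp, of "[(Cup a, 0)]" "\<not> a" 0 True "[(Cap, 0)]"]
    by (simp add: pretzel_diagram_def column_def bottom_def numeral_2_eq_2)
  then show ?thesis
    using conway_reduces_to[OF C] link_diagram_pretzel[of "[1, -1]" a] conway_unlink[OF C] True by simp
next
  case False
  then show ?thesis
    using conway_reduces_to[OF C reduces_to_cancel_columns[OF False]] link_diagram_pretzel[of "qs @ [1, -1]" a]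
      assms(2) by simp
qed

lemma coeff_z_mult: "coeff ([:0, 1:] * (f :: int poly)) n = (if n = 0 then 0 else coeff f (n - 1))"
  by (cases n) auto

text \<open>The recursion takes the coefficient of z^2 for odd length to that of z for even length,
  and this to the constant one for odd length. The factors 8 and 2 keep the statement within the
  integers.\<close>

lemma conway_pretzel_coeffs:
  assumes C: "conway_polynomial C"
  shows "\<forall>x \<in> set ps. odd x \<Longrightarrow> ps \<noteq> [] \<Longrightarrow>
    (if odd (length ps) then coeff (C (pretzel_diagram a ps)) 0 = 1 \<and>
       8 * coeff (C (pretzel_diagram a ps)) 2
         = (sum_list ps)\<^sup>2 - sum_list (map (\<lambda>p. p\<^sup>2) ps) + int (length ps) - 1
     else coeff (C (pretzel_diagram a ps)) 0 = 0 \<and> 2 * coeff (C (pretzel_diagram a ps)) 1 = - sum_list ps)"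
proof (induction "length ps" arbitrary: ps rule: less_induct)
  case less
  define F where "F = (\<lambda>ps. C (pretzel_diagram a ps))"
  show ?case
  proof (cases "length ps = 1")
    case True
    then obtain p where "ps = [p]" by (auto simp: length_Suc_conv)
    then show ?thesis using conway_pretzel_singleton[OF C, of p a] less.prems by simp
  next
    case False
    obtain qs' q where "ps = qs' @ [q]" using less.prems(2) by (cases ps rule: rev_cases) auto
    moreover from this False obtain qs p where "qs' = qs @ [p]" by (cases qs' rule: rev_cases) auto
    ultimately have ps: "ps = qs @ [p, q]" by simp
    from less.prems(1) obtain k j where k: "p = 2 * k + 1" and j: "q = 2 * j + 1" and qs: "\<forall>x \<in> set qs. odd x"
      unfolding ps by (auto elim!: oddE)
    have step: "F ps = (if qs = [] then 0 else F qs)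
        - smult (j + 1) ([:0, 1:] * F (qs @ [1])) - smult k ([:0, 1:] * F (qs @ [q]))"
      using conway_pretzel_step[OF C qs] conway_pretzel_cancelling[OF C qs] by (simp add: ps k j F_def)
    have IH1: "if odd (length qs) then coeff (F (qs @ [x])) 0 = 0 \<and> 2 * coeff (F (qs @ [x])) 1 = - sum_list qs - x
      else coeff (F (qs @ [x])) 0 = 1" if "odd x" for x
      using less.hyps[of "qs @ [x]"] qs that by (simp add: ps F_def split: if_splits)
    have IH1': "if odd (length qs) then coeff (F (qs @ [1])) 0 = 0 \<and> 2 * coeff (F (qs @ [1])) 1 = - sum_list qs - 1
      else coeff (F (qs @ [1])) 0 = 1" using IH1[of 1] by simp
    have IH1'': "if odd (length qs) then coeff (F (qs @ [q])) 0 = 0 \<and> 2 * coeff (F (qs @ [q])) 1 = - sum_list qs - q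
      else coeff (F (qs @ [q])) 0 = 1" using IH1[of q] j by simp
    have IH0: "qs \<noteq> [] \<Longrightarrow> if odd (length qs) then coeff (F qs) 0 = 1 \<and>
       8 * coeff (F qs) 2 = (sum_list qs)\<^sup>2 - sum_list (map (\<lambda>p. p\<^sup>2) qs) + int (length qs) - 1
     else coeff (F qs) 0 = 0 \<and> 2 * coeff (F qs) 1 = - sum_list qs"
      using less.hyps[of qs] qs by (simp add: ps F_def split: if_splits)
    have "if odd (length ps) then coeff (F ps) 0 = 1 \<and>
       8 * coeff (F ps) 2 = (sum_list ps)\<^sup>2 - sum_list (map (\<lambda>p. p\<^sup>2) ps) + int (length ps) - 1
     else coeff (F ps) 0 = 0 \<and> 2 * coeff (F ps) 1 = - sum_list ps"
    proof (cases "odd (length qs)")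
      case True
      then have "qs \<noteq> []" by auto
      note h = IH0[OF this] IH1' IH1''
      \<comment> \<open>Multiplication by z lowers the index, so the links \<open>qs @ [1]\<close>
        and \<open>qs @ [q]\<close>, of even length, enter through their linking numbers.\<close>
      have "8 * coeff (F ps) 2 = 8 * coeff (F qs) 2
          - 4 * (j + 1) * (2 * coeff (F (qs @ [1])) 1) - 4 * k * (2 * coeff (F (qs @ [q])) 1)"
        using \<open>qs \<noteq> []\<close> unfolding step coeff_diff coeff_smult coeff_z_mult by simp
      also have "\<dots> = (sum_list qs)\<^sup>2 - sum_list (map (\<lambda>p. p\<^sup>2) qs) + int (length qs) - 1
          - 4 * (j + 1) * (- sum_list qs - 1) - 4 * k * (- sum_list qs - q)"
        using h True by presburger
      \<comment> \<open>The length grows by 2, and 2 p q + 2 = 4 (j + 1) + 4 k q.\<close>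
      also have "\<dots> = (sum_list ps)\<^sup>2 - sum_list (map (\<lambda>p. p\<^sup>2) ps) + int (length ps) - 1"
        by (simp add: ps k j power2_eq_square algebra_simps)
      finally have c2: "8 * coeff (F ps) 2 = \<dots>" .
      have "coeff (F ps) 0 = coeff (F qs) 0"
        using \<open>qs \<noteq> []\<close> unfolding step coeff_diff coeff_smult coeff_z_mult by simp
      with c2 h(1) True show ?thesis by (simp add: ps)
    next
      case False
      have "coeff (F ps) 0 = 0"
        using IH0 False unfolding step coeff_diff coeff_smult coeff_z_mult by simp
      \<comment> \<open>Both smoothed diagrams are knots with constant coefficient 1, so they
        contribute -(j + 1) - k, which is half of -(p + q). If \<open>qs\<close> is empty, the first
        term of \<open>step\<close> is 0, in accordance with the empty sum.\<close>
      moreover have "2 * coeff (F ps) 1 = - sum_list ps"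
        using IH0 IH1' IH1'' False unfolding step coeff_diff coeff_smult coeff_z_mult
        by (cases "qs = []") (simp_all add: ps k j algebra_simps)
      ultimately show ?thesis using False by (simp add: ps)
    qed
    then show ?thesis by (simp only: F_def)
  qed
qed

section \<open>The orientation of a pretzel knot of odd type\<close>

lemma unoriented_append: "unoriented (D @ E) = unoriented D @ unoriented E"
  by (simp add: unoriented_def)

text \<open>An orientation of the bottom row amounts to a choice of labels. The row is taken apart
  from its right end to match \<open>bottom_snoc\<close>.\<close>

lemma unoriented_eq_cups:
  "unoriented D = map (\<lambda>j. (Cup (), 2 * j + 1)) [0..<m] \<Longrightarrow>
    \<exists>es. length es = m \<and> (Cup d, 0) # D = bottom d es"
proof (induction m arbitrary: D)
  case 0
  then show ?case by (simp add: unoriented_def)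
next
  case (Suc m)
  then obtain E c where D: "D = E @ [c]" "unoriented E = map (\<lambda>j. (Cup (), 2 * j + 1)) [0..<m]"
    "unoriented [c] = [(Cup (), 2 * m + 1)]"
    by (auto simp: unoriented_def map_eq_append_conv)
  obtain e where "c = (Cup e, 2 * m + 1)"
    using D(3) by (cases c; cases "fst c") (auto simp: unoriented_def)
  moreover obtain es where "length es = m" "(Cup d, 0) # E = bottom d es"
    using Suc.IH[OF D(2)] by blast
  ultimately show ?case using D(1) by (intro exI[of _ "es @ [e]"]) (simp add: bottom_snoc)
qed

text \<open>Only cups are decorated, so forgetting orientations loses nothing on the columns and
  caps.\<close>

lemma unoriented_inject:
  "unoriented D = unoriented E \<Longrightarrow> \<forall>(x, i) \<in> set E. \<forall>d. x \<noteq> Cup d \<Longrightarrow> D = E"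
proof (induction E arbitrary: D)
  case (Cons c E)
  then obtain b D' where D: "D = b # D'" "unoriented D' = unoriented E" "unoriented [b] = unoriented [c]"
    by (auto simp: unoriented_def)
  moreover have "b = c"
    using D(3) Cons.prems(2)
    by (cases b; cases c; cases "fst b"; cases "fst c") (auto simp: unoriented_def)
  ultimately show ?case using Cons by simp
qed (simp add: unoriented_def)

lemma pretzel_eq:
  "pretzel ps = (Cup (), 0) # map (\<lambda>j. (Cup (), 2 * j + 1)) [0..<length ps - 1]
     @ unoriented (columns 0 ps @ caps (length ps - 1))"
proof -
  have "concat (map (\<lambda>j. replicate (nat \<bar>ps ! j\<bar>) (Cross (ps ! j > 0), 2 * j)) [0..<length ps])
      = unoriented (columns 0 ps)"
  proof (induction ps rule: rev_induct)
    case (snoc p ps)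
    let ?f = "\<lambda>ps j. replicate (nat \<bar>ps ! j\<bar>) (Cross (ps ! j > 0) :: unit piece, 2 * j)"
    have "map (?f (ps @ [p])) [0..<length ps] = map (?f ps) [0..<length ps]"
      by (intro map_cong) (auto simp: nth_append)
    then have "concat (map (?f (ps @ [p])) [0..<length (ps @ [p])])
        = unoriented (columns 0 ps) @ ?f (ps @ [p]) (length ps)"
      using snoc by (simp del: map_eq_conv)
    then show ?case
      by (simp add: columns_append unoriented_append) (simp add: unoriented_def column_def)
  qed (simp add: unoriented_def)
  moreover have "rev (map (\<lambda>j. (Cap, 2 * j + 1)) [0..<m]) @ [(Cap, 0)] = unoriented (caps m)" for m
    by (induction m) (auto simp: unoriented_def)
  ultimately show ?thesis by (simp add: pretzel_def Let_def unoriented_append)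
qed

text \<open>Any orientation has the form \<open>bottom a es\<close> followed by the columns and
  caps. An odd number of columns means an even number of inner arcs, and
  \<open>alternating_if_capped\<close> then leaves only the choice of \<open>a\<close>.\<close>

lemma oriented_pretzel_unique:
  assumes "oriented_pretzel ps P" "odd (length ps)" "\<forall>p \<in> set ps. odd p"
  shows "\<exists>a. P = pretzel_diagram a ps"
proof -
  define m where "m = length ps - 1"
  have m: "length ps = Suc m" "even m" using assms(2) by (cases ps; simp add: m_def)+
  from assms(1) have P: "path [] P []" "unoriented P = pretzel ps"
    by (simp_all add: oriented_pretzel_def link_diagram_def)
  let ?cups = "map (\<lambda>j. (Cup (), 2 * j + 1)) [0..<m]"
  from P(2) obtain c R where R: "P = c # R" "unoriented [c] = [(Cup (), 0)]"
    "unoriented R = ?cups @ unoriented (columns 0 ps @ caps m)"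
    unfolding pretzel_eq m_def[symmetric] by (cases P) (simp_all add: unoriented_def)
  moreover from R(3) obtain D E where "R = D @ E" "unoriented D = ?cups"
    "unoriented E = unoriented (columns 0 ps @ caps m)"
    unfolding unoriented_def map_eq_append_conv[of _ R] by metis
  ultimately have D: "P = c # D @ E" "unoriented [c] = [(Cup (), 0)]" "unoriented D = ?cups"
    "unoriented E = unoriented (columns 0 ps @ caps m)" by simp_all
  obtain a where c: "c = (Cup a, 0)"
    using D(2) by (cases c; cases "fst c") (auto simp: unoriented_def)
  obtain es where es: "length es = m" "(Cup a, 0) # D = bottom a es"
    using unoriented_eq_cups[OF D(3)] by blast
  have "(Cup d, i) \<notin> set (caps m)" for d i
    by (induction m) auto
  moreover have "(Cup d, i) \<notin> set (columns 0 ps)" for d i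
    using columns_crosses by blast
  ultimately have "\<forall>(x, i) \<in> set (columns 0 ps @ caps m). \<forall>d. x \<noteq> Cup d"
    by fastforce
  from unoriented_inject[OF D(4) this] have "E = columns 0 ps @ caps m" .
  with D(1) c es have PE: "P = bottom a es @ columns 0 ps @ caps m" by simp
  let ?s = "a # legs es @ [\<not> a]"
  have "path ?s (columns 0 ps) (swap_pairs ?s)"
    using path_columns[of "[]" 0 ?s ps "[]"] assms(3) m(1) es(1) by simp
  then have "path (swap_pairs ?s) (caps m) []"
    using P(1) path_bottom[of a es] unfolding PE path_append_iff by (metis path_functional)
  then obtain b fs where fs: "length fs = m" "swap_pairs ?s = b # legs fs @ [\<not> b]"
    unfolding path_caps_iff by blast
  have "es = replicate (length es) (\<not> a)"
    using alternating_if_capped[OF fs(2)] fs(1) es(1) m(2) by simp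
  with PE es(1) show ?thesis unfolding pretzel_diagram_def m_def by metis
qed

section \<open>From sums over lists to the two forms of the formula\<close>

lemma square_sum_pairs:
  fixes x :: "nat \<Rightarrow> rat"
  shows "(\<Sum>i = 1..n. x i)\<^sup>2 - (\<Sum>i = 1..n. (x i)\<^sup>2)
    = 2 * (\<Sum>(i, j) \<in> {(i, j). 1 \<le> i \<and> i < j \<and> j \<le> n}. x i * x j)"
proof (induction n)
  case 0
  have "{(i, j). 1 \<le> i \<and> i < j \<and> j \<le> (0::nat)} = {}" by auto
  then show ?case by (simp only: sum.empty) simp
next
  case (Suc n)
  let ?S = "\<lambda>n. {(i, j). 1 \<le> i \<and> i < j \<and> j \<le> (n::nat)}"
  \<comment> \<open>The new pairs are those with larger index \<open>Suc n\<close>; they supply the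
    mixed term of the square.\<close>
  have "?S (Suc n) = ?S n \<union> (\<lambda>i. (i, Suc n)) ` {1..n}" by (auto simp: le_Suc_eq)
  moreover have "finite (?S n)" by (rule finite_subset[of _ "{..n} \<times> {..n}"]) auto
  ultimately have "(\<Sum>(i, j) \<in> ?S (Suc n). x i * x j)
      = (\<Sum>(i, j) \<in> ?S n. x i * x j) + (\<Sum>(i, j) \<in> (\<lambda>i. (i, Suc n)) ` {1..n}. x i * x j)"
    by (simp only:) (rule sum.union_disjoint, auto)
  also have "(\<Sum>(i, j) \<in> (\<lambda>i. (i, Suc n)) ` {1..n}. x i * x j) = (\<Sum>i = 1..n. x i) * x (Suc n)"
    by (subst sum.reindex) (auto simp: inj_on_def sum_distrib_right)
  finally show ?case using Suc by (simp add: power2_eq_square algebra_simps)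
qed

theorem lemma1p3:
  fixes n :: nat and p :: "nat \<Rightarrow> int"
    and C :: "bool diagram \<Rightarrow> int poly" and P :: "bool diagram"
  assumes "odd n"
    and "\<forall>i\<in>{1..n}. odd (p i)"
    and "conway_polynomial C"
    and "oriented_pretzel (map p [1..<n + 1]) P"
  shows "rat_of_int (a2 C P) =
           1 / 4 * (\<Sum>(i, j) \<in> {(i, j). 1 \<le> i \<and> i < j \<and> j \<le> n}. rat_of_int (p i) * rat_of_int (p j))
           + 1 / 8 * (rat_of_nat n - 1)
         \<and> rat_of_int (a2 C P) =
           1 / 8 * ((\<Sum>i = 1..n. rat_of_int (p i))\<^sup>2 - (\<Sum>i = 1..n. (rat_of_int (p i))\<^sup>2))
           + 1 / 8 * (rat_of_nat n - 1)"
proof -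
  let ?ps = "map p [1..<n + 1]"
  have odd: "\<forall>x \<in> set ?ps. odd x" using assms(2) by auto
  obtain a where "P = pretzel_diagram a ?ps"
    using oriented_pretzel_unique[OF assms(4) _ odd] assms(1) by (auto simp del: upt_Suc)
  moreover have "?ps \<noteq> []" using assms(1) by (cases n) auto
  ultimately have "8 * a2 C P = (sum_list ?ps)\<^sup>2 - sum_list (map (\<lambda>p. p\<^sup>2) ?ps) + int n - 1"
    using conway_pretzel_coeffs[OF assms(3) odd, of a] assms(1) by (simp add: a2_def del: upt_Suc)
  also have "sum_list ?ps = (\<Sum>i = 1..n. p i)"
    by (simp add: interv_sum_list_conv_sum_set_nat atLeastLessThanSuc_atLeastAtMost del: upt_Suc)
  also have "sum_list (map (\<lambda>p. p\<^sup>2) ?ps) = (\<Sum>i = 1..n. (p i)\<^sup>2)"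
    by (simp add: comp_def interv_sum_list_conv_sum_set_nat atLeastLessThanSuc_atLeastAtMost del: upt_Suc)
  finally have "rat_of_int (8 * a2 C P) = rat_of_int ((\<Sum>i = 1..n. p i)\<^sup>2 - (\<Sum>i = 1..n. (p i)\<^sup>2) + int n - 1)"
    by (rule arg_cong)
  then show ?thesis
    using square_sum_pairs[of "\<lambda>i. rat_of_int (p i)" n] by (simp add: field_simps)
qed

end
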